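(* Let $\boldsymbol{G}=\begin{bmatrix}\boldsymbol{A}&\boldsymbol{B}\\ \boldsymbol{B}^T&\boldsymbol{\Gamma}\end{bmatrix}\in\mathbb{S}^{n+m}$ be an arrow-type matrix, i.e. $\boldsymbol{A}=\sum_{k=1}^p\boldsymbol{A}_k$ with $\boldsymbol{A}_k\in\mathbb{S}^n$, $\boldsymbol{B}=\sum_{k=1}^p\boldsymbol{B}_k$ with $\boldsymbol{B}_k\in\mathbb{R}^{n\times m}$, $\boldsymbol{\Gamma}\in\mathbb{S}^m$, with associated index sets $\mathcal{I}_1,\dots,\mathcal{I}_p$. Suppose that $\boldsymbol{A}_k\succeq 0$ for all $k\in[p]$ and $\boldsymbol{\Gamma}\succeq 0$. Then the following statements are equivalent: (i) $\boldsymbol{G}\succeq 0$; (ii) there exist matrices $\boldsymbol{D}_{k,\ell}\in\mathbb{R}^{n\times m}$ ($1\le k<\ell\le p$) such that $(\boldsymbol{D}_{k,\ell})_{ij}=0$ whenever $(i,j)\notin\mathcal{I}_{k,\ell}\times[m]$, and symmetric matrices $\boldsymbol{C}_k\in\mathbb{S}^m$ ($k\in[p]$), such that, setting $$\boldsymbol{D}_k=-\sum_{\ell:\ell<k}\boldsymbol{D}_{\ell,k}+\sum_{\ell:\ell>k}\boldsymbol{D}_{k,\ell},\qquad \widetilde{\boldsymbol{G}}_k=\begin{bmatrix}\boldsymbol{A}_k&\boldsymbol{B}_k\\ \boldsymbol{B}_k^T&\boldsymbol{0}\end{bmatrix}+\begin{bmatrix}\boldsymbol{0}&\boldsymbol{D}_k\\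 \boldsymbol{D}_k^T&\boldsymbol{C}_k\end{bmatrix},$$ one has $\sum_{k=1}^p\boldsymbol{C}_k=\boldsymbol{\Gamma}$, $\boldsymbol{G}=\sum_{k=1}^p\widetilde{\boldsymbol{G}}_k$, and $\widetilde{\boldsymbol{G}}_k\succeq 0$ for all $k\in[p]$.
   Context: $[n]=\{1,\dots,n\}$; $\mathbb{S}^n$ is the space of real symmetric $n\times n$ matrices; $\boldsymbol{M}\succeq0$ means $\boldsymbol{M}$ is positive semidefinite. For each $k\in[p]$, $\mathcal{I}_k\subseteq[n]$ is the set of indices of the nonzero rows/columns of $\boldsymbol{A}_k$. The sets $\mathcal{I}_k$ may overlap and $\bigcup_{k}\mathcal{I}_k=[n]$. The matrices $\boldsymbol{B}_k$ satisfy $(\boldsymbol{B}_k)_{ij}=0$ for $i\notin\mathcal{I}_k$. For $k<\ell$, $\mathcal{I}_{k,\ell}=\mathcal{I}_k\cap\mathcal{I}_\ell$. *)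

theory Defs
  imports "HOL-Analysis.Analysis"
begin

definition symmetric_matrix :: "real^'n^'n \<Rightarrow> bool" where
  "symmetric_matrix M \<longleftrightarrow> transpose M = M"

definition psd :: "real^'n^'n \<Rightarrow> bool" where
  "psd M \<longleftrightarrow> symmetric_matrix M \<and> (\<forall>x. 0 \<le> x \<bullet> (M *v x))"

(* For symmetric matrices, the only ones it is used for, the nonzero rows and the
   nonzero columns have the same indices. *)
definition index_set :: "real^'n^'n \<Rightarrow> 'n set" where
  "index_set M = {i. row i M \<noteq> 0}"

(* The matrix with rows [P Q] and [R S]. Indices are in the sum type: Inl is the first
   block and Inr the second, so R^(n+m) is modelled by real^('n + 'm). An n x m matrix
   (n rows, m columns) has type real^'m^'n. *)
definition block_matrix ::
  "real^'n^'n \<Rightarrow> real^'m^'n \<Rightarrow> real^'n^'m \<Rightarrow> real^'m^'m \<Rightarrow> real^('n + 'm)^('n + 'm)" where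
  "block_matrix P Q R S = (\<chi> r c.
     (case r of
        Inl i \<Rightarrow> (case c of Inl j \<Rightarrow> P $ i $ j | Inr j \<Rightarrow> Q $ i $ j)
      | Inr i \<Rightarrow> (case c of Inl j \<Rightarrow> R $ i $ j | Inr j \<Rightarrow> S $ i $ j)))"

end

theory Submission
  imports Defs
begin

text \<open>
  The implication from the decomposition to \<open>psd G\<close> is closure of positive semidefiniteness under
  sums. For the converse write \<open>A\<close>, \<open>B\<close> for the sums of the \<open>A k\<close> and \<open>B k\<close>. A positive
  semidefinite block matrix with upper blocks \<open>A\<close> and \<open>B\<close> satisfies \<open>B = A ** X\<close> for some \<open>X\<close>
  (\<open>psd_block_factor\<close>), because every vector in the kernel of the symmetric matrix \<open>A\<close> is
  orthogonal to the columns of \<open>B\<close>. Hence, by completing the square,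
  the Schur complement \<open>S = \<Gamma> - transpose X ** (A ** X)\<close> is positive semidefinite
  (\<open>psd_block_schur\<close>).

  The same \<open>X\<close> splits everything: \<open>B\<close> is the sum of the matrices \<open>A k ** X\<close>, and \<open>\<Gamma>\<close> is
  the sum of the \<open>transpose X ** (A k ** X)\<close> plus \<open>S\<close>, where \<open>S\<close> may be added to any one
  summand. The block matrix with blocks \<open>A k\<close> and \<open>A k ** X\<close> and the corresponding summand of
  \<open>\<Gamma>\<close> is then positive semidefinite, again by the Schur complement.

  It remains to realise the corrections \<open>A k ** X - B k\<close> as differences of pairwise transfers
  \<open>D k l\<close> supported on the common rows of \<open>k\<close> and \<open>l\<close>. The corrections sum to zero and
  vanish outside the rows of \<open>index_set (A k)\<close>. So in each row \<open>i\<close> separately they form a balanced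
  system on the set of all \<open>k\<close> with \<open>i \<in> index_set (A k)\<close>; any two members of that set may
  exchange row \<open>i\<close>, and letting all of them exchange only with the least member already balances
  everything (\<open>pairwise_transfers_exist\<close>).
\<close>

section \<open>Positive semidefinite matrices\<close>

lemma symmetric_matrix_sym_inner:
  assumes "symmetric_matrix M"
  shows "x \<bullet> (M *v y) = y \<bullet> (M *v x)"
  using assms unfolding symmetric_matrix_def
  by (metis dot_lmul_matrix inner_commute transpose_matrix_vector)

lemma symmetric_matrix_add:
  "symmetric_matrix M \<Longrightarrow> symmetric_matrix N \<Longrightarrow> symmetric_matrix (M + N)"
  by (simp add: symmetric_matrix_def transpose_def vec_eq_iff)

lemma symmetric_matrix_diff:
  "symmetric_matrix M \<Longrightarrow> symmetric_matrix N \<Longrightarrow> symmetric_matrix (M - N)"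
  by (simp add: symmetric_matrix_def transpose_def vec_eq_iff)

lemma symmetric_matrix_congruence:
  fixes M :: "real^'n^'n" and X :: "real^'m^'n"
  assumes "symmetric_matrix M"
  shows "symmetric_matrix (transpose X ** (M ** X))"
  using assms unfolding symmetric_matrix_def
  by (simp add: matrix_transpose_mul transpose_transpose matrix_mul_assoc)

lemma psd_0: "psd 0"
  by (simp add: psd_def symmetric_matrix_def transpose_def vec_eq_iff)

lemma psd_add: "psd M \<Longrightarrow> psd N \<Longrightarrow> psd (M + N)"
  by (simp add: psd_def symmetric_matrix_add matrix_vector_mult_add_rdistrib inner_add_right)

lemma psd_sum: "(\<And>k. k \<in> K \<Longrightarrow> psd (M k)) \<Longrightarrow> psd (\<Sum>k\<in>K. M k)"
  by (induction K rule: infinite_finite_induct) (auto simp: psd_0 psd_add)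

lemma transpose_sum: "transpose (\<Sum>k\<in>K. M k :: real^'m^'n) = (\<Sum>k\<in>K. transpose (M k))"
  by (simp add: transpose_def vec_eq_iff)

lemma matrix_mul_sum_left:
  fixes M :: "'k \<Rightarrow> real^'n^'l" and X :: "real^'m^'n"
  shows "(\<Sum>k\<in>K. M k) ** X = (\<Sum>k\<in>K. M k ** X)"
  by (induction K rule: infinite_finite_induct) 
    (simp_all add: matrix_matrix_mult_def vec_eq_iff sum.distrib distrib_right)

lemma matrix_mul_sum_right:
  fixes M :: "'k \<Rightarrow> real^'m^'n" and Y :: "real^'n^'l"
  shows "Y ** (\<Sum>k\<in>K. M k) = (\<Sum>k\<in>K. Y ** M k)"
  by (induction K rule: infinite_finite_induct) (auto simp: matrix_add_ldistrib)

text \<open>The range of a symmetric matrix is the orthogonal complement of its kernel; this is the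
  inclusion that solves linear systems.\<close>

lemma symmetric_matrix_solvable:
  fixes M :: "real^'n^'n"
  assumes sym: "symmetric_matrix M"
    and ortho: "\<And>v. M *v v = 0 \<Longrightarrow> v \<bullet> b = 0"
  shows "\<exists>x. M *v x = b"
proof -
  have sub: "subspace (range ((*v) M))"
    by (intro linear_subspace_image) (auto intro: matrix_vector_mul_linear)
  then have span: "span (range ((*v) M)) = range ((*v) M)"
    by (simp add: span_eq_iff)
  obtain y z where y: "y \<in> range ((*v) M)"
    and z: "\<And>w. w \<in> range ((*v) M) \<Longrightarrow> orthogonal z w" and b: "b = y + z"
    using orthogonal_subspace_decomp_exists[of "range ((*v) M)" b] unfolding span by metis
  have "(M *v z) \<bullet> (M *v z) = 0"
    using z[of "M *v (M *v z)"] symmetric_matrix_sym_inner[OF sym, of z "M *v z"]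
    by (simp add: orthogonal_def)
  then have "z \<bullet> b = 0"
    using ortho by simp
  moreover have "z \<bullet> y = 0"
    using z[OF y] by (simp add: orthogonal_def)
  ultimately have "z = 0"
    by (simp add: b inner_add_right)
  with y b show ?thesis by auto
qed

section \<open>Block matrices and the Schur complement\<close>

lemma sum_UNIV_sum_type:
  "(\<Sum>r\<in>(UNIV :: ('a::finite + 'b::finite) set). f r) = (\<Sum>i\<in>UNIV. f (Inl i)) + (\<Sum>j\<in>UNIV. f (Inr j))"
  by (simp add: UNIV_Plus_UNIV[symmetric] sum.Plus del: UNIV_Plus_UNIV)

lemma block_matrix_add:
  "block_matrix P Q R S + block_matrix P' Q' R' S' =
    block_matrix (P + P') (Q + Q') (R + R') (S + S')"
  by (auto simp: block_matrix_def vec_eq_iff split: sum.split)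

lemma block_matrix_sum:
  "(\<Sum>k\<in>K. block_matrix (P k) (Q k) (R k) (S k)) =
    block_matrix (\<Sum>k\<in>K. P k) (\<Sum>k\<in>K. Q k) (\<Sum>k\<in>K. R k) (\<Sum>k\<in>K. S k)"
  by (auto simp: block_matrix_def vec_eq_iff split: sum.split)

lemma symmetric_block_matrix_iff:
  "symmetric_matrix (block_matrix P Q (transpose Q) S) \<longleftrightarrow>
    symmetric_matrix P \<and> symmetric_matrix S"
  by (auto simp: symmetric_matrix_def block_matrix_def transpose_def vec_eq_iff split_sum_all)

definition join_vec :: "real^'n \<Rightarrow> real^'m \<Rightarrow> real^('n + 'm)" where
  "join_vec u w = (\<chi> r. case r of Inl i \<Rightarrow> u $ i | Inr j \<Rightarrow> w $ j)"

lemma join_vec_cases: obtains u w where "z = join_vec u w"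
proof
  show "z = join_vec (\<chi> i. z $ Inl i) (\<chi> j. z $ Inr j)"
    by (simp add: join_vec_def vec_eq_iff split_sum_all)
qed

lemma join_vec_inner: "join_vec u w \<bullet> join_vec u' w' = u \<bullet> u' + w \<bullet> w'"
  by (simp add: join_vec_def inner_vec_def sum_UNIV_sum_type)

lemma block_matrix_join_vec:
  "block_matrix P Q R S *v join_vec u w = join_vec (P *v u + Q *v w) (R *v u + S *v w)"
  by (simp add: block_matrix_def join_vec_def vec_eq_iff matrix_vector_mult_def
      sum_UNIV_sum_type split_sum_all)

lemma block_matrix_quadratic_form:
  "join_vec u w \<bullet> (block_matrix P Q (transpose Q) S *v join_vec u w) =
    u \<bullet> (P *v u) + 2 * (u \<bullet> (Q *v w)) + w \<bullet> (S *v w)"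
proof -
  have "w \<bullet> (transpose Q *v u) = u \<bullet> (Q *v w)"
    by (metis dot_lmul_matrix inner_commute transpose_matrix_vector)
  then show ?thesis
    by (simp add: block_matrix_join_vec join_vec_inner inner_add_right)
qed

lemma psd_block_matrix_iff:
  "psd (block_matrix P Q (transpose Q) S) \<longleftrightarrow>
    symmetric_matrix P \<and> symmetric_matrix S \<and>
    (\<forall>u w. 0 \<le> u \<bullet> (P *v u) + 2 * (u \<bullet> (Q *v w)) + w \<bullet> (S *v w))"
  unfolding psd_def symmetric_block_matrix_iff
  by (metis block_matrix_quadratic_form join_vec_cases)

text \<open>If \<open>P v = 0\<close>, the quadratic form is affine in the coefficient of \<open>v\<close>, hence can only stay
  nonnegative if \<open>v\<close> is orthogonal to every \<open>Q w\<close>; so the columns of \<open>Q\<close> lie in the range of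
  \<open>P\<close>.\<close>

lemma psd_block_factor:
  fixes P :: "real^'n^'n" and Q :: "real^'m^'n"
  assumes psd: "psd (block_matrix P Q (transpose Q) S)"
  obtains X where "Q = P ** X"
proof -
  have sym: "symmetric_matrix P"
    and form: "0 \<le> u \<bullet> (P *v u) + 2 * (u \<bullet> (Q *v w)) + w \<bullet> (S *v w)" for u w
    using psd unfolding psd_block_matrix_iff by auto
  have ker: "v \<bullet> (Q *v w) = 0" if v: "P *v v = 0" for v w
  proof (rule ccontr)
    assume nz: "v \<bullet> (Q *v w) \<noteq> 0"
    \<comment> \<open>Choose the multiple of \<open>v\<close> at which the form takes the value \<open>- 1\<close>.\<close>
    define t where "t = - (1 + w \<bullet> (S *v w)) / (2 * (v \<bullet> (Q *v w)))"
    have "2 * (t * (v \<bullet> (Q *v w))) = - (1 + w \<bullet> (S *v w))"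
      using nz by (simp add: t_def)
    moreover have "P *v (t *\<^sub>R v) = 0"
      using v by (simp add: matrix_vector_mult_scaleR)
    ultimately show False
      using form[of "t *\<^sub>R v" w] by simp
  qed
  have "\<exists>x. P *v x = column j Q" for j
    using ker[of _ "axis j 1"]
    by (intro symmetric_matrix_solvable[OF sym]) (simp add: matrix_vector_mult_basis)
  then obtain x where x: "\<And>j. P *v x j = column j Q"
    by metis
  have "Q = P ** (\<chi> i j. x j $ i)"
    using x by (simp add: vec_eq_iff matrix_matrix_mult_def matrix_vector_mult_def column_def)
  then show thesis ..
qed

text \<open>Completing the square: \<open>u \<bullet> P u + 2 u \<bullet> P X w + w \<bullet> S w\<close> is the value of \<open>P\<close> at
  \<open>u + X w\<close> plus the value of the Schur complement at \<open>w\<close>, and \<open>u + X w\<close> and \<open>w\<close> can be chosen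
  independently.\<close>

lemma psd_block_schur:
  fixes P :: "real^'n^'n" and X :: "real^'m^'n"
  shows "psd (block_matrix P (P ** X) (transpose (P ** X)) S) \<longleftrightarrow>
    psd P \<and> psd (S - transpose X ** (P ** X))"
proof (cases "symmetric_matrix P")
  case False
  then show ?thesis unfolding psd_block_matrix_iff by (simp add: psd_def)
next
  case sym: True
  let ?T = "S - transpose X ** (P ** X)"
  have symT: "symmetric_matrix ?T \<longleftrightarrow> symmetric_matrix S"
    using symmetric_matrix_congruence[OF sym, of X]
      symmetric_matrix_add[of ?T "transpose X ** (P ** X)"]
    by (auto intro: symmetric_matrix_diff)
  have square: "u \<bullet> (P *v u) + 2 * (u \<bullet> ((P ** X) *v w)) + w \<bullet> (S *v w) =
      (u + X *v w) \<bullet> (P *v (u + X *v w)) + w \<bullet> (?T *v w)" for u w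
  proof -
    have "w \<bullet> ((transpose X ** (P ** X)) *v w) = (X *v w) \<bullet> (P *v (X *v w))"
      by (metis dot_lmul_matrix matrix_vector_mul_assoc transpose_matrix_vector
          transpose_transpose)
    then show ?thesis
      using symmetric_matrix_sym_inner[OF sym, of u "X *v w"]
      by (simp add: matrix_vector_mult_diff_rdistrib matrix_vector_right_distrib
          matrix_vector_mul_assoc[symmetric] inner_add_left inner_add_right inner_diff_right)
  qed
  have "(\<forall>u w. 0 \<le> (u + X *v w) \<bullet> (P *v (u + X *v w)) + w \<bullet> (?T *v w)) \<longleftrightarrow>
      (\<forall>x. 0 \<le> x \<bullet> (P *v x)) \<and> (\<forall>w. 0 \<le> w \<bullet> (?T *v w))" (is "?L \<longleftrightarrow> ?R")
  proof
    assume L: ?L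
    show ?R
    proof (intro conjI allI)
      fix x show "0 \<le> x \<bullet> (P *v x)"
        using L[rule_format, of x 0] by simp
    next
      fix w show "0 \<le> w \<bullet> (?T *v w)"
        using L[rule_format, of "- (X *v w)" w] by simp
    qed
  qed (simp add: add_nonneg_nonneg)
  then show ?thesis
    unfolding psd_block_matrix_iff square using sym symT by (auto simp: psd_def)
qed

section \<open>Balanced families as pairwise transfers\<close>

text \<open>In row \<open>i\<close>, each index whose set contains \<open>i\<close> settles its entry with the least such
  index, \<open>hub i\<close>; since the row sums to zero, these transfers add up at the hub to the hub's own
  entry. As the hub is least, it always occurs as the first argument of \<open>D\<close>, whence the
  single sign.\<close>

lemma pairwise_transfers_exist:
  fixes E :: "nat \<Rightarrow> real^'m^'n" and I :: "nat \<Rightarrow> 'n set"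
  assumes supp: "\<And>k i j. k \<in> {1..p} \<Longrightarrow> i \<notin> I k \<Longrightarrow> E k $ i $ j = 0"
    and balanced: "(\<Sum>k=1..p. E k) = 0"
  obtains D :: "nat \<Rightarrow> nat \<Rightarrow> real^'m^'n"
  where "\<And>k l i j. i \<notin> I k \<inter> I l \<Longrightarrow> D k l $ i $ j = 0"
    and "\<And>k. k \<in> {1..p} \<Longrightarrow> E k = - (\<Sum>l\<in>{1..<k}. D l k) + (\<Sum>l\<in>{k<..p}. D k l)"
proof -
  define hub where "hub i = (LEAST k. k \<in> {1..p} \<and> i \<in> I k)" for i
  define D :: "nat \<Rightarrow> nat \<Rightarrow> real^'m^'n" where
    "D k l = (\<chi> i j. if i \<in> I k \<inter> I l \<and> k = hub i then - (E l $ i $ j) else 0)" for k l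
  have "E k $ i $ j = - (\<Sum>l\<in>{1..<k}. D l k $ i $ j) + (\<Sum>l\<in>{k<..p}. D k l $ i $ j)"
    if k: "k \<in> {1..p}" for k i j
  proof (cases "i \<in> I k")
    case False
    then show ?thesis using supp[OF k] by (simp add: D_def)
  next
    case True
    with k have hub: "hub i \<in> {1..p}" "i \<in> I (hub i)" and le: "hub i \<le> k"
      unfolding hub_def
      by (metis (mono_tags, lifting) LeastI, metis (mono_tags, lifting) LeastI,
          simp add: Least_le)
    have below: "E l $ i $ j = 0" if "l \<in> {1..p}" "l < hub i" for l
      using that supp not_less_Least[of l "\<lambda>k. k \<in> {1..p} \<and> i \<in> I k"] unfolding hub_def by auto
    show ?thesis
    proof (cases "hub i = k")
      case eq: True
      have "(\<Sum>l\<in>{1..<k}. D l k $ i $ j) = 0"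
        using eq by (intro sum.neutral) (auto simp: D_def)
      moreover have "(\<Sum>l\<in>{k<..p}. D k l $ i $ j) = (\<Sum>l\<in>{k<..p}. - (E l $ i $ j))"
        using eq True k supp by (intro sum.cong) (auto simp: D_def)
      moreover have "0 = (\<Sum>l\<in>{1..p}. E l $ i $ j)"
        using balanced by (metis sum_component zero_index)
      moreover have "\<dots> = (\<Sum>l\<in>insert k {k<..p}. E l $ i $ j)"
        using below eq k by (intro sum.mono_neutral_right) (auto simp: not_less le_less)
      ultimately show ?thesis
        by (simp add: sum_negf)
    next
      case False
      have "(\<Sum>l\<in>{1..<k}. D l k $ i $ j) = (\<Sum>l\<in>{1..<k}. if l = hub i then - (E k $ i $ j) else 0)"
        using hub True by (intro sum.cong) (auto simp: D_def)
      also have "\<dots> = - (E k $ i $ j)"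
        using hub le False by simp
      finally show ?thesis
        using False by (simp add: D_def)
    qed
  qed
  then have "E k = - (\<Sum>l\<in>{1..<k}. D l k) + (\<Sum>l\<in>{k<..p}. D k l)" if "k \<in> {1..p}" for k
    using that by (simp add: vec_eq_iff)
  moreover have "D k l $ i $ j = 0" if "i \<notin> I k \<inter> I l" for k l i j
    using that by (auto simp: D_def)
  ultimately show thesis using that by blast
qed

section \<open>Decomposition of arrow-type matrices\<close>

theorem theorem3:
  fixes p :: nat
    and A :: "nat \<Rightarrow> real^'n^'n"
    and B :: "nat \<Rightarrow> real^'m^'n"
    and \<Gamma> :: "real^'m^'m"
    and G :: "real^('n + 'm)^('n + 'm)"
  assumes A_sym: "\<And>k. k \<in> {1..p} \<Longrightarrow> symmetric_matrix (A k)"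
    and \<Gamma>_sym: "symmetric_matrix \<Gamma>"
    and cover: "(\<Union>k\<in>{1..p}. index_set (A k)) = UNIV"
    and B_supp: "\<And>k i j. k \<in> {1..p} \<Longrightarrow> i \<notin> index_set (A k) \<Longrightarrow> B k $ i $ j = 0"
    and G_def: "G = block_matrix (\<Sum>k=1..p. A k) (\<Sum>k=1..p. B k)
                      (transpose (\<Sum>k=1..p. B k)) \<Gamma>"
    and A_psd: "\<And>k. k \<in> {1..p} \<Longrightarrow> psd (A k)"
    and \<Gamma>_psd: "psd \<Gamma>"
  shows "psd G \<longleftrightarrow>
    (\<exists>(D :: nat \<Rightarrow> nat \<Rightarrow> real^'m^'n) (C :: nat \<Rightarrow> real^'m^'m).
       (\<forall>k\<in>{1..p}. \<forall>l\<in>{k<..p}. \<forall>i j.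
          i \<notin> index_set (A k) \<inter> index_set (A l) \<longrightarrow> D k l $ i $ j = 0) \<and>
       (\<forall>k\<in>{1..p}. symmetric_matrix (C k)) \<and>
       (let D' = (\<lambda>k. - (\<Sum>l\<in>{1..<k}. D l k) + (\<Sum>l\<in>{k<..p}. D k l));
            G' = (\<lambda>k. block_matrix (A k) (B k) (transpose (B k)) 0
                       + block_matrix 0 (D' k) (transpose (D' k)) (C k))
        in (\<Sum>k=1..p. C k) = \<Gamma> \<and>
           G = (\<Sum>k=1..p. G' k) \<and>
           (\<forall>k\<in>{1..p}. psd (G' k))))" (is "_ \<longleftrightarrow> ?rhs")
proof
  assume psdG: "psd G"
  let ?A = "\<Sum>k=1..p. A k" and ?B = "\<Sum>k=1..p. B k"
  obtain X where X: "?B = ?A ** X"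
    using psdG psd_block_factor unfolding G_def by blast
  define S where "S = \<Gamma> - transpose X ** (?A ** X)"
  have psdS: "psd S"
    using psdG psd_block_schur unfolding G_def X S_def by blast
  define E where "E k = A k ** X - B k" for k
  have "1 \<le> p"
    using cover by (cases p) auto

  have E_supp: "E k $ i $ j = 0" if "k \<in> {1..p}" "i \<notin> index_set (A k)" for k i j
    using that B_supp[OF that]
    by (simp add: E_def index_set_def row_def vec_eq_iff matrix_matrix_mult_def)
  have "(\<Sum>k=1..p. E k) = 0"
    by (simp only: E_def sum_subtractf X matrix_mul_sum_left diff_self)
  then obtain D where D_supp:
      "\<And>k l i j. i \<notin> index_set (A k) \<inter> index_set (A l) \<Longrightarrow> D k l $ i $ j = 0"
    and D: "\<And>k. k \<in> {1..p} \<Longrightarrow>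
      E k = - (\<Sum>l\<in>{1..<k}. D l k) + (\<Sum>l\<in>{k<..p}. D k l)"
    using pairwise_transfers_exist[of p "\<lambda>k. index_set (A k)" E] E_supp by blast

  \<comment> \<open>The Schur complement left over is assigned to the first summand.\<close>
  define C where "C k = transpose X ** (A k ** X) + (if k = 1 then S else 0)" for k
  have C_sym: "symmetric_matrix (C k)" if "k \<in> {1..p}" for k
    using psdS psd_0 A_sym[OF that] unfolding C_def psd_def
    by (auto intro: symmetric_matrix_add symmetric_matrix_congruence)
  have C_sum: "(\<Sum>k=1..p. C k) = \<Gamma>"
    using \<open>1 \<le> p\<close>
    by (simp add: C_def sum.distrib S_def matrix_mul_sum_left matrix_mul_sum_right)

  define D' where "D' k = - (\<Sum>l\<in>{1..<k}. D l k) + (\<Sum>l\<in>{k<..p}. D k l)" for k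
  define G' where "G' k = block_matrix (A k) (B k) (transpose (B k)) 0
      + block_matrix 0 (D' k) (transpose (D' k)) (C k)" for k
  have G': "G' k = block_matrix (A k) (A k ** X) (transpose (A k ** X)) (C k)"
    if "k \<in> {1..p}" for k
  proof -
    have "B k + D' k = A k ** X"
      using D[OF that] unfolding E_def D'_def[symmetric] by (simp add: algebra_simps)
    moreover have "transpose (B k) + transpose (D' k) = transpose (B k + D' k)"
      by (simp add: transpose_def vec_eq_iff)
    ultimately show ?thesis
      by (simp add: G'_def block_matrix_add)
  qed
  have "psd (G' k)" if "k \<in> {1..p}" for k
    unfolding G'[OF that] psd_block_schur using A_psd[OF that] psdS by (simp add: C_def psd_0)
  moreover have "G = (\<Sum>k=1..p. G' k)"
  proof -
    have "(\<Sum>k=1..p. G' k) =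
        (\<Sum>k=1..p. block_matrix (A k) (A k ** X) (transpose (A k ** X)) (C k))"
      by (intro sum.cong refl G')
    then show ?thesis
      by (simp add: block_matrix_sum C_sum G_def X matrix_mul_sum_left transpose_sum
          del: One_nat_def)
  qed
  ultimately show "?rhs"
    using D_supp C_sym C_sum unfolding Let_def G'_def D'_def
    by (intro exI[of _ D] exI[of _ C]) auto
next
  assume "?rhs"
  then show "psd G"
    unfolding Let_def by (metis (no_types, lifting) psd_sum)
qed

end
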